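(* Let $R$ be a topological ring and let $X$ be a semitopological $R$-module with multiplication $*:R\times X\to X$. (1) For any $R$-bounded set $B\subseteq X$ the multiplication map $R\times B\to X$, $(r,x)\mapsto r*x$, is (jointly) continuous. (2) If the space $R$ is strongly Baire, then each compact subset of $X$ is $R$-bounded.
   Context: All topological spaces are Tychonoff. A topological ring is a unital ring (not necessarily commutative) with a Hausdorff topology making addition and multiplication jointly continuous. A semitopological $R$-module is a unital left $R$-module $X$ (with multiplication written $*:R\times X\to X$) endowed with a Hausdorff topology making $X$ an Abelian topological group and making $*$ separately continuous. A subset $B\subseteq X$ is $R$-bounded if for every neighborhood $U\subseteq X$ of zero there is a neighborhood $V\subseteq R$ of zero such that $V*B\subseteq U$, where $V*B=\{v*b:v\in V,\ b\in B\}$. Strongly Baire: For a topological space $S$ and a dense subset $D\subseteq S$, the Cao–Moors game is played by players I and II. Player I starts by choosing a non-empty open set $U_0\subseteq S$, and II responds with a non-empty open $V_0\subseteq U_0$; at inning $n\ge 1$, I chooses a non-empty open $U_n\subseteq V_{n-1}$ and II responds with a non-empty open $V_n\subseteq U_n$. Player II wins if $\bigcap_{n}U_n\neq\emptyset$ and every sequence $(x_n)_{n\in\omega}\in\prod_{n\in\omega}(V_n\cap D)$ has a cluster point in $S$; otherwise I wins. The space $S$ is strongly Baire if for some dense subset $D$ of $S$ player I has no winning strategy in this game. *)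

theory Defs
  imports "HOL-Analysis.Analysis"
begin

(* The library class ring_1 would exclude the zero ring (it contains 0 \<noteq> 1); a unital ring is
   therefore rendered as ring + monoid_mult.  Continuity of negation need not be required, since
   - x = (- 1) * x. *)
class topological_ring =
  ring + monoid_mult + topological_monoid_add + topological_semigroup_mult + t2_space

(* The library locale module needs a commutative scalar ring. *)
locale semitopological_module =
  fixes smul :: "'r::topological_ring \<Rightarrow> 'x::{topological_ab_group_add, t2_space} \<Rightarrow> 'x"
      (infixr \<open>*m\<close> 75)
  assumes smul_add_right: "r *m (x + y) = r *m x + r *m y"
    and smul_add_left: "(r + s) *m x = r *m x + s *m x"
    and smul_smul: "(r * s) *m x = r *m (s *m x)"
    and smul_one: "1 *m x = x"
    and continuous_smul_right: "continuous_on UNIV (\<lambda>x. r *m x)"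
    and continuous_smul_left: "continuous_on UNIV (\<lambda>r. r *m x)"

(* A neighborhood of zero is a set, not necessarily open, with zero in its interior. *)
definition R_bounded ::
    "('r::{topological_space, zero} \<Rightarrow> 'x::{topological_space, zero} \<Rightarrow> 'x) \<Rightarrow> 'x set \<Rightarrow> bool"
  where "R_bounded smul B \<longleftrightarrow>
    (\<forall>U. 0 \<in> interior U \<longrightarrow>
      (\<exists>V. 0 \<in> interior V \<and> {smul v b | v b. v \<in> V \<and> b \<in> B} \<subseteq> U))"

definition cluster_point :: "'a topology \<Rightarrow> (nat \<Rightarrow> 'a) \<Rightarrow> 'a \<Rightarrow> bool"
  where "cluster_point S x p \<longleftrightarrow>
    p \<in> topspace S \<and> (\<forall>W. openin S W \<and> p \<in> W \<longrightarrow> (\<exists>\<^sub>F n in sequentially. x n \<in> W))"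

(* A strategy \<sigma> of player I maps the list [V 0, ..., V (n - 1)] of the answers of player II so far
   to the next move U n; in particular \<sigma> [] = U 0.  Such a list is a legal history if each of its
   entries is a legal answer to the move that \<sigma> prescribed before it. *)
definition legal_history :: "'a topology \<Rightarrow> ('a set list \<Rightarrow> 'a set) \<Rightarrow> 'a set list \<Rightarrow> bool"
  where "legal_history S \<sigma> Vs \<longleftrightarrow>
    (\<forall>i<length Vs. openin S (Vs ! i) \<and> Vs ! i \<noteq> {} \<and> Vs ! i \<subseteq> \<sigma> (take i Vs))"

definition strategy_I :: "'a topology \<Rightarrow> ('a set list \<Rightarrow> 'a set) \<Rightarrow> bool"
  where "strategy_I S \<sigma> \<longleftrightarrow>
    (\<forall>Vs. legal_history S \<sigma> Vs \<longrightarrow>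
      openin S (\<sigma> Vs) \<and> \<sigma> Vs \<noteq> {} \<and> (Vs \<noteq> [] \<longrightarrow> \<sigma> Vs \<subseteq> last Vs))"

definition wins_II :: "'a topology \<Rightarrow> 'a set \<Rightarrow> (nat \<Rightarrow> 'a set) \<Rightarrow> (nat \<Rightarrow> 'a set) \<Rightarrow> bool"
  where "wins_II S D U V \<longleftrightarrow>
    (\<Inter>n. U n) \<noteq> {} \<and> (\<forall>x. (\<forall>n. x n \<in> V n \<inter> D) \<longrightarrow> (\<exists>p. cluster_point S x p))"

definition winning_strategy_I :: "'a topology \<Rightarrow> 'a set \<Rightarrow> ('a set list \<Rightarrow> 'a set) \<Rightarrow> bool"
  where "winning_strategy_I S D \<sigma> \<longleftrightarrow>
    strategy_I S \<sigma> \<and>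
    (\<forall>V. (\<forall>n. legal_history S \<sigma> (map V [0..<n])) \<longrightarrow>
      \<not> wins_II S D (\<lambda>n. \<sigma> (map V [0..<n])) V)"

definition strongly_Baire :: "'a topology \<Rightarrow> bool"
  where "strongly_Baire S \<longleftrightarrow>
    (\<exists>D \<subseteq> topspace S. S closure_of D = topspace S \<and> (\<nexists>\<sigma>. winning_strategy_I S D \<sigma>))"

end

theory Submission
  imports Defs
begin

text \<open>
  Part (1) is the identity \<open>r x - r\<^sub>0 x\<^sub>0 = (r - r\<^sub>0) x + r\<^sub>0 (x - x\<^sub>0)\<close>: boundedness makes the first
  summand small uniformly in \<open>x \<in> B\<close>, and separate continuity takes care of the second.

  Part (2) is a double limit argument played out in the Cao--Moors game.  Let \<open>K\<close> be compact, let
  \<open>U\<close> be a neighborhood of zero in \<open>X\<close>, and assume that no neighborhood of zero in \<open>R\<close> multiplies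
  \<open>K\<close> into \<open>U\<close>.  Then player I has a winning strategy, whatever the dense set \<open>D\<close> is.
  Fix open symmetric neighborhoods \<open>A\<^sub>0 \<subseteq> U\<close> and \<open>A\<^sub>n\<^sub>+\<^sub>1 + A\<^sub>n\<^sub>+\<^sub>1 \<subseteq> A\<^sub>n\<close> of zero.  The main point
  (\<open>escaping_difference\<close>) is that finitely many scalars never control all of an open set \<open>V \<subseteq> R\<close> of
  scalars: some difference \<open>z\<close> of two points of \<open>K\<close> is made as small as desired by the given
  scalars while some \<open>s \<in> V\<close> keeps \<open>s z\<close> out of \<open>A\<^sub>2\<close>.  Otherwise the given scalars would induce a
  totally bounded notion of closeness on the compact set \<open>K\<close>, and every scalar of \<open>V\<close> would map
  close points of \<open>K\<close> to points that agree up to \<open>A\<^sub>2\<close>; controlling a scalar of \<open>V\<close> on \<open>K\<close> would then amount to controlling it at finitely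
  many points, which separate continuity permits, and translating to zero yields a neighborhood
  that multiplies \<open>K\<close> into \<open>U\<close>.

  Player I picks \<open>r\<^sub>n\<close> in each answer \<open>V\<^sub>n\<close> of player II (within \<open>D\<close>), takes such a difference \<open>z\<^sub>n\<close>
  with \<open>r\<^sub>j z\<^sub>n \<in> A\<^sub>n\<close> for all \<open>j \<le> n\<close>, and shrinks \<open>V\<^sub>n\<close> to an open set of scalars that keep \<open>z\<^sub>n\<close>
  outside the closure of \<open>A\<^sub>3\<close> (\<open>separating_move\<close>).  If \<open>(r\<^sub>n)\<close> had a cluster point \<open>r\<close>, take a
  cluster point \<open>z\<close> of \<open>(z\<^sub>n)\<close>, which exists by compactness.  Fixing \<open>n\<close> first gives
  \<open>r z\<^sub>n \<notin> A\<^sub>3\<close>, hence \<open>r z \<notin> A\<^sub>3\<close>.  Fixing \<open>j\<close> first gives \<open>r\<^sub>j z \<in> \<Inter>\<^sub>n A\<^sub>n\<close>; this intersection is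
  closed, so \<open>r z \<in> \<Inter>\<^sub>n A\<^sub>n\<close>, a contradiction (\<open>no_cluster_of_separated\<close>).
  Hence \<open>(r\<^sub>n)\<close> has no cluster point, and player II has lost.
\<close>

section \<open>Cluster points of sequences\<close>

lemma cluster_point_closed:
  assumes "cluster_point euclidean x p" and "continuous_on UNIV g" and "closed C"
    and "\<forall>\<^sub>F n in sequentially. g (x n) \<in> C"
  shows "g p \<in> C"
proof (rule ccontr)
  assume "g p \<notin> C"
  moreover have "open (g -` (- C))"
    using assms(2,3) by (intro open_vimage) auto
  ultimately have "\<exists>\<^sub>F n in sequentially. x n \<in> g -` (- C)"
    using assms(1) unfolding cluster_point_def by auto
  then have "\<exists>\<^sub>F n in sequentially. x n \<in> g -` (- C) \<and> g (x n) \<in> C"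
    using assms(4) by (rule frequently_eventually_frequently)
  then show False by simp
qed

text \<open>
  In a space without countable neighborhood bases a sequence in a compact set need not have a
  convergent subsequence; its image filter still has a cluster point.
\<close>
lemma compact_cluster_point:
  assumes "compact K" and "\<And>n. x n \<in> K"
  obtains p where "cluster_point euclidean x p"
proof -
  let ?F = "filtermap x sequentially"
  have "?F \<le> principal K" "?F \<noteq> bot"
    using assms(2) by (auto simp: le_principal eventually_filtermap filtermap_bot_iff)
  then obtain p where p: "inf (nhds p) ?F \<noteq> bot"
    using assms(1) unfolding compact_filter le_principal by blast
  have "\<exists>\<^sub>F n in sequentially. x n \<in> W" if W: "open W" "p \<in> W" for W
  proof (rule ccontr)
    assume "\<not> (\<exists>\<^sub>F n in sequentially. x n \<in> W)"
    then have "eventually (\<lambda>y. y \<notin> W) ?F"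
      by (simp add: not_frequently eventually_filtermap)
    moreover have "eventually (\<lambda>y. y \<in> W) (nhds p)"
      using W by (rule eventually_nhds_in_open)
    ultimately have "eventually (\<lambda>y. False) (inf (nhds p) ?F)"
      unfolding eventually_inf by blast
    then show False using p by (simp add: trivial_limit_def)
  qed
  then show thesis
    by (intro that[of p]) (simp add: cluster_point_def)
qed

section \<open>Halving neighborhoods of zero\<close>

lemma open_symmetric_half:
  fixes U :: "'x::topological_ab_group_add set"
  assumes "open U" "0 \<in> U"
  obtains W where "open W" "0 \<in> W" "\<And>x. x \<in> W \<Longrightarrow> - x \<in> W"
    "\<And>x y. x \<in> W \<Longrightarrow> y \<in> W \<Longrightarrow> x + y \<in> U"
proof -
  have "open ((\<lambda>p::'x \<times> 'x. fst p + snd p) -` U)"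
    using assms(1) by (intro open_vimage continuous_intros)
  then obtain A B where AB: "open A" "open B" "(0, 0) \<in> A \<times> B"
      "A \<times> B \<subseteq> (\<lambda>p. fst p + snd p) -` U"
    using assms(2) by (elim open_prod_elim[where x = "(0, 0)"]) auto
  define W where "W = (A \<inter> B) \<inter> uminus -` (A \<inter> B)"
  have "open W"
    unfolding W_def using AB by (intro open_Int open_vimage continuous_intros)
  then show thesis
    using AB by (intro that[of W]) (auto simp: W_def)
qed

text \<open>
  Such a chain does the work of a continuous pseudonorm on the group: it generates a group topology,
  possibly coarser than the given one, in which \<open>\<Inter>n. A n\<close> is the closure of zero.
\<close>
definition halving_chain :: "(nat \<Rightarrow> 'x::topological_ab_group_add set) \<Rightarrow> bool"
  where "halving_chain A \<longleftrightarrow>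
    (\<forall>n. open (A n) \<and> 0 \<in> A n \<and> (\<forall>x\<in>A n. - x \<in> A n) \<and>
      (\<forall>x\<in>A (Suc n). \<forall>y\<in>A (Suc n). x + y \<in> A n))"

lemma halving_chain_open: "halving_chain A \<Longrightarrow> open (A n)"
  and halving_chain_zero: "halving_chain A \<Longrightarrow> 0 \<in> A n"
  and halving_chain_uminus: "halving_chain A \<Longrightarrow> x \<in> A n \<Longrightarrow> - x \<in> A n"
  and halving_chain_add:
    "halving_chain A \<Longrightarrow> x \<in> A (Suc n) \<Longrightarrow> y \<in> A (Suc n) \<Longrightarrow> x + y \<in> A n"
  unfolding halving_chain_def by blast+

lemma halving_chain_exists:
  fixes U :: "'x::topological_ab_group_add set"
  assumes "open U" "0 \<in> U"
  obtains A where "halving_chain A" "A 0 \<subseteq> U"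
proof -
  let ?P = "\<lambda>W::'x set. open W \<and> 0 \<in> W \<and> (\<forall>x\<in>W. - x \<in> W)"
  obtain W0 where W0: "?P W0" "\<And>x y. x \<in> W0 \<Longrightarrow> y \<in> W0 \<Longrightarrow> x + y \<in> U"
    using open_symmetric_half[OF assms] by metis
  have "\<exists>A. \<forall>n. (?P (A n) \<and> (n = 0 \<longrightarrow> A n = W0)) \<and>
      (\<forall>x\<in>A (Suc n). \<forall>y\<in>A (Suc n). x + y \<in> A n)"
  proof (rule dependent_nat_choice)
    show "\<exists>W. ?P W \<and> ((0::nat) = 0 \<longrightarrow> W = W0)"
      using W0 by blast
  next
    fix W and n :: nat
    assume "?P W \<and> (n = 0 \<longrightarrow> W = W0)"
    then obtain W' where "?P W'" "\<And>x y. x \<in> W' \<Longrightarrow> y \<in> W' \<Longrightarrow> x + y \<in> W"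
      using open_symmetric_half[of W] by metis
    then show "\<exists>W'. (?P W' \<and> (Suc n = 0 \<longrightarrow> W' = W0)) \<and> (\<forall>x\<in>W'. \<forall>y\<in>W'. x + y \<in> W)"
      by blast
  qed
  then obtain A where A: "\<And>n. ?P (A n)" "A 0 = W0"
      "\<And>n. \<forall>x\<in>A (Suc n). \<forall>y\<in>A (Suc n). x + y \<in> A n"
    by blast
  have "W0 \<subseteq> U"
    using W0(2)[of _ 0] W0(1) by auto
  then show thesis
    using A by (intro that[of A]) (auto simp: halving_chain_def)
qed

text \<open>
  This lets limits be taken at the price of one step in the chain; it also shows that \<open>\<Inter>n. A n\<close> is
  closed.
\<close>
lemma halving_chain_closure:
  assumes A: "halving_chain A"
  shows "closure (A (Suc n)) \<subseteq> A n"
proof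
  fix x assume x: "x \<in> closure (A (Suc n))"
  let ?T = "(\<lambda>y. x - y) -` A (Suc n)"
  have "open ?T"
    using halving_chain_open[OF A] by (intro open_vimage continuous_on_op_minus)
  moreover have "x \<in> ?T"
    using halving_chain_zero[OF A] by simp
  ultimately have "?T \<inter> A (Suc n) \<noteq> {}"
    using x open_Int_closure_eq_empty[of ?T "A (Suc n)"] by blast
  then obtain y where y: "y \<in> A (Suc n)" "x - y \<in> A (Suc n)"
    by auto
  then have "(x - y) + y \<in> A n"
    using A unfolding halving_chain_def by blast
  then show "x \<in> A n" by simp
qed

section \<open>Boundedness and separating scalars\<close>

context semitopological_module
begin

lemma smul_diff_right: "r *m (x - y) = r *m x - r *m y"
  using smul_add_right[of r "x - y" y] by (simp add: algebra_simps)

lemma smul_diff_left: "(r - s) *m x = r *m x - s *m x"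
  using smul_add_left[of "r - s" s x] by (simp add: algebra_simps)

lemma smul_zero_right: "r *m 0 = 0"
  using smul_diff_right[of r 0 0] by simp

lemma smul_zero_left: "0 *m x = 0"
  using smul_diff_left[of 0 0 x] by simp

lemma continuous_on_smul_bounded:
  assumes "R_bounded smul B"
  shows "continuous_on (UNIV \<times> B) (\<lambda>(r, x). r *m x)"
  unfolding continuous_on_def
proof
  fix p :: "'r \<times> 'x" assume "p \<in> UNIV \<times> B"
  obtain r0 x0 where p: "p = (r0, x0)" by force
  let ?F = "at p within UNIV \<times> B"
  have fst: "((\<lambda>q. fst q - r0) \<longlongrightarrow> 0) ?F"
  proof -
    have "((\<lambda>q. fst q + - r0) \<longlongrightarrow> fst p + - r0) ?F"
      by (intro tendsto_intros)
    then show ?thesis by (simp add: p)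
  qed
  have small: "((\<lambda>q. (fst q - r0) *m snd q) \<longlongrightarrow> 0) ?F"
  proof (rule topological_tendstoI)
    fix S :: "'x set" assume S: "open S" "0 \<in> S"
    then have "0 \<in> interior S" by (simp add: interior_open)
    then obtain V where V: "0 \<in> interior V" "{v *m b | v b. v \<in> V \<and> b \<in> B} \<subseteq> S"
      using assms unfolding R_bounded_def by blast
    have "eventually (\<lambda>q. fst q - r0 \<in> interior V) ?F"
      using V by (intro topological_tendstoD[OF fst]) auto
    moreover have "eventually (\<lambda>q. q \<in> UNIV \<times> B) ?F"
      by (simp add: eventually_at_filter)
    ultimately show "eventually (\<lambda>q. (fst q - r0) *m snd q \<in> S) ?F"
      by eventually_elim (use V interior_subset in fastforce)
  qed
  have "((\<lambda>q. r0 *m snd q) \<longlongrightarrow> r0 *m x0) ?F"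
  proof (rule continuous_on_tendsto_compose[OF continuous_smul_right])
    show "(snd \<longlongrightarrow> x0) ?F"
      using tendsto_snd[OF tendsto_ident_at[of p "UNIV \<times> B"]] by (simp add: p)
  qed auto
  from tendsto_add[OF small this]
  show "((\<lambda>(r, x). r *m x) \<longlongrightarrow> (case p of (r, x) \<Rightarrow> r *m x)) ?F"
    by (simp add: p smul_diff_left case_prod_unfold)
qed

text \<open>
  If every \<open>z\<close> on which the scalars of \<open>F\<close> are small were moved into \<open>A 2\<close> by all of \<open>V\<close>, cover the
  compact set \<open>K\<close> by finitely many \<open>F\<close>-small pieces around points \<open>y \<in> Y\<close>.  A scalar \<open>s\<close> close to
  \<open>s\<^sub>0 \<in> V\<close> at the points of \<open>Y\<close> is then close to \<open>s\<^sub>0\<close> on all of \<open>K\<close>, because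
  \<open>(s - s\<^sub>0) x = s (x - y) + (s y - s\<^sub>0 y) - s\<^sub>0 (x - y)\<close> has three summands in \<open>A 2\<close>.
\<close>
lemma escaping_difference:
  assumes K: "compact K" and A: "halving_chain A"
    and unb: "\<And>V. open V \<Longrightarrow> 0 \<in> V \<Longrightarrow> \<exists>v\<in>V. \<exists>x\<in>K. v *m x \<notin> A 0"
    and F: "finite F" and W: "open W" "0 \<in> W" and V: "open V" "V \<noteq> {}"
  obtains z s where "z \<in> {x - y | x y. x \<in> K \<and> y \<in> K}" "\<forall>p\<in>F. p *m z \<in> W"
    "s \<in> V" "s *m z \<notin> A 2"
proof (rule ccontr)
  note wit = that
  assume no: "\<not> thesis"
  have equi: "s *m (x - y) \<in> A 2"
    if "s \<in> V" "x \<in> K" "y \<in> K" "\<forall>p\<in>F. p *m (x - y) \<in> W" for s x y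
    using no wit[of "x - y" s] that by blast
  define G where "G y = (\<Inter>p\<in>F. (\<lambda>x. p *m (x - y)) -` W)" for y
  have "open (G y)" for y
    unfolding G_def using F W(1)
    by (intro open_INT ballI open_vimage
        continuous_on_compose2[OF continuous_smul_right] continuous_intros) auto
  moreover have "K \<subseteq> (\<Union>y\<in>K. G y)"
    using W(2) by (auto simp: G_def smul_zero_right intro!: bexI)
  ultimately obtain Y where Y: "Y \<subseteq> K" "finite Y" "K \<subseteq> (\<Union>y\<in>Y. G y)"
    using compactE_image[OF K] by metis
  obtain s0 where s0: "s0 \<in> V" using V by blast
  \<comment> \<open>The scalars \<open>v\<close> for which \<open>s = s0 + v\<close> stays in \<open>V\<close> and is close to \<open>s0\<close> at each point of \<open>Y\<close>.\<close>
  define H where "H = (\<lambda>v. s0 + v) -` V \<inter> (\<Inter>y\<in>Y. (\<lambda>v. v *m y) -` A 2)"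
  note Aop = halving_chain_open[OF A, of 2] halving_chain_zero[OF A, of 2]
  have "open H"
    unfolding H_def using V Y(2) Aop
    by (intro open_Int open_INT ballI open_vimage continuous_smul_left continuous_intros)
  moreover have "0 \<in> H"
    using s0 Aop by (auto simp: H_def smul_zero_left)
  ultimately obtain v x where v: "v \<in> H" "x \<in> K" "v *m x \<notin> A 0"
    using unb by blast
  obtain y where y: "y \<in> Y" "x \<in> G y" using Y v by blast
  have small: "\<forall>p\<in>F. p *m (x - y) \<in> W" using y by (auto simp: G_def)
  have "(s0 + v) *m (x - y) \<in> A 2" "s0 *m (x - y) \<in> A 2"
    using equi small v s0 y Y by (auto simp: H_def)
  moreover have "v *m y \<in> A 2"
    using v y by (auto simp: H_def)
  ultimately have two: "(s0 + v) *m (x - y) + v *m y \<in> A 1" "- (s0 *m (x - y)) + 0 \<in> A 1"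
    using Aop(2) unfolding numeral_2_eq_2 One_nat_def
    by (blast intro: halving_chain_add[OF A] halving_chain_uminus[OF A])+
  \<comment> \<open>Three summands from \<open>A 2\<close>, padded with zero so that two halvings apply.\<close>
  have "((s0 + v) *m (x - y) + v *m y) + (- (s0 *m (x - y)) + 0) \<in> A 0"
    using two unfolding One_nat_def by (rule halving_chain_add[OF A])
  moreover have "((s0 + v) *m (x - y) + v *m y) + (- (s0 *m (x - y)) + 0) = v *m x"
    by (simp add: smul_add_left smul_diff_right)
  ultimately show False using v by simp
qed

text \<open>
  The single scalar that escapes is thickened to an open set; passing from \<open>A 2\<close> to the closure of
  \<open>A 3\<close> is what makes room for this.
\<close>
lemma separating_move:
  assumes K: "compact K" and A: "halving_chain A"
    and unb: "\<And>V. open V \<Longrightarrow> 0 \<in> V \<Longrightarrow> \<exists>v\<in>V. \<exists>x\<in>K. v *m x \<notin> A 0"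
    and F: "finite F" and W: "open W" "0 \<in> W" and V: "open V" "V \<noteq> {}"
  obtains U z where "open U" "U \<noteq> {}" "U \<subseteq> V" "z \<in> {x - y | x y. x \<in> K \<and> y \<in> K}"
    "\<forall>p\<in>F. p *m z \<in> W" "\<forall>s\<in>U. s *m z \<notin> closure (A 3)"
proof -
  obtain z s where z: "z \<in> {x - y | x y. x \<in> K \<and> y \<in> K}" "\<forall>p\<in>F. p *m z \<in> W"
    and s: "s \<in> V" "s *m z \<notin> A 2"
    by (rule escaping_difference[OF assms])
  define U where "U = V \<inter> (\<lambda>s. s *m z) -` (- closure (A 3))"
  show thesis
  proof (rule that[OF _ _ _ z])
    show "open U"
      unfolding U_def using V by (intro open_Int open_vimage continuous_smul_left) auto
    have "closure (A 3) \<subseteq> A 2"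
      using halving_chain_closure[OF A, of 2] by (simp add: eval_nat_numeral)
    then have "s \<in> U"
      using s by (auto simp: U_def)
    then show "U \<noteq> {}" by blast
    show "U \<subseteq> V" "\<forall>s\<in>U. s *m z \<notin> closure (A 3)"
      by (auto simp: U_def)
  qed
qed

text \<open>
  At a cluster point \<open>p\<close> of \<open>r\<close> and a cluster point \<open>q\<close> of \<open>z\<close> the two iterated limits of \<open>r k *m z n\<close>
  disagree about \<open>p *m q\<close>: letting \<open>k\<close> go first puts it outside \<open>A m\<close> (by \<open>far\<close>), letting \<open>n\<close> go
  first puts it into every member of the chain (by \<open>near\<close>).
\<close>
lemma no_cluster_of_separated:
  assumes A: "halving_chain A" and L: "compact L" "\<And>n. z n \<in> L"
    and near: "\<And>j n. j \<le> n \<Longrightarrow> r j *m z n \<in> A n"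
    and far: "\<And>n k. n < k \<Longrightarrow> r k *m z n \<notin> closure (A m)"
  shows "\<not> cluster_point euclidean r p"
proof
  assume p: "cluster_point euclidean r p"
  obtain q where q: "cluster_point euclidean z q"
    by (rule compact_cluster_point[OF L])
  note Aop = halving_chain_open[OF A]
  have mono: "A (Suc n) \<subseteq> A n" for n
    using halving_chain_closure[OF A] closure_subset by blast
  have "p *m z n \<in> - A m" for n
  proof (rule cluster_point_closed[OF p continuous_smul_left])
    show "\<forall>\<^sub>F k in sequentially. r k *m z n \<in> - A m"
      using eventually_gt_at_top[of n] by eventually_elim (use far closure_subset in blast)
  qed (use Aop in auto)
  then have "p *m q \<in> - A m"
    by (intro cluster_point_closed[OF q continuous_smul_right]) (use Aop in auto)
  moreover have "r j *m q \<in> closure (A (Suc m))" for j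
  proof (rule cluster_point_closed[OF q continuous_smul_right])
    show "\<forall>\<^sub>F n in sequentially. r j *m z n \<in> closure (A (Suc m))"
      using eventually_ge_at_top[of "max j (Suc m)"]
    proof eventually_elim
      case (elim n)
      then have "A n \<subseteq> A (Suc m)"
        using lift_Suc_antimono_le[of A "Suc m" n] mono by auto
      then show ?case using near[of j n] elim closure_subset by auto
    qed
  qed auto
  then have "p *m q \<in> closure (A (Suc m))"
    by (intro cluster_point_closed[OF p continuous_smul_left]) auto
  ultimately show False
    using halving_chain_closure[OF A] by blast
qed

section \<open>A winning strategy for player I\<close>

text \<open>
  Player I answers \<open>V n\<close> by a \<open>separating_move\<close> against the scalars picked from \<open>V 0, \<dots>, V n\<close>.  The
  next answers lie inside this move, so the scalars picked from them meet the hypotheses of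
  \<open>no_cluster_of_separated\<close>.
\<close>
lemma winning_strategy_of_unbounded:
  fixes D :: "'r set"
  assumes K: "compact K" and A: "halving_chain A"
    and unb: "\<And>V. open V \<Longrightarrow> 0 \<in> V \<Longrightarrow> \<exists>v\<in>V. \<exists>x\<in>K. v *m x \<notin> A 0"
    and D: "closure D = UNIV"
  shows "\<exists>\<sigma>. winning_strategy_I (euclidean :: 'r topology) D \<sigma>"
proof -
  define L where "L = {x - y | x y. x \<in> K \<and> y \<in> K}"
  have "compact ((\<lambda>p. fst p - snd p) ` (K \<times> K))"
    using K by (intro compact_continuous_image compact_Times continuous_intros)
  moreover have "(\<lambda>p. fst p - snd p) ` (K \<times> K) = L"
    unfolding L_def by force
  ultimately have L: "compact L" by simp
  \<comment> \<open>The scalar \<open>pick V\<close> that player I selects from an answer \<open>V\<close> of player II depends on \<open>V\<close> only,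
    so the earlier selections can be recovered from the history.\<close>
  have "\<exists>r. r \<in> V \<inter> D" if "open V" "V \<noteq> {}" for V
    using D that open_Int_closure_eq_empty[of V D] by auto
  then obtain pick where pick: "\<And>V. open V \<Longrightarrow> V \<noteq> {} \<Longrightarrow> pick V \<in> V \<inter> D"
    by metis
  \<comment> \<open>The history \<open>[V 0, \<dots>, V n]\<close> has length \<open>n + 1\<close> and calls for smallness \<open>A n\<close>.\<close>
  define good where "good Vs U z \<longleftrightarrow> open U \<and> U \<noteq> {} \<and> U \<subseteq> last Vs \<and> z \<in> L \<and>
      (\<forall>V\<in>set Vs. pick V *m z \<in> A (length Vs - 1)) \<and> (\<forall>s\<in>U. s *m z \<notin> closure (A 3))"
    for Vs U z
  have good_ex: "\<exists>U z. good Vs U z" if ne: "open (last Vs)" "last Vs \<noteq> {}" for Vs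
  proof -
    have fin: "finite (pick ` set Vs)" by simp
    obtain U z where "open U" "U \<noteq> {}" "U \<subseteq> last Vs" "z \<in> L"
      "\<forall>p\<in>pick ` set Vs. p *m z \<in> A (length Vs - 1)" "\<forall>s\<in>U. s *m z \<notin> closure (A 3)"
      unfolding L_def
      by (rule separating_move[OF K A unb fin halving_chain_open[OF A, of "length Vs - 1"]
            halving_chain_zero[OF A] ne])
    then have "good Vs U z" by (simp add: good_def)
    then show ?thesis by blast
  qed
  define \<sigma> where "\<sigma> Vs = (if Vs = [] then UNIV else SOME U. \<exists>z. good Vs U z)" for Vs
  have \<sigma>: "\<exists>z. good Vs (\<sigma> Vs) z"
    if "legal_history euclidean \<sigma> Vs" "Vs \<noteq> []" for Vs
  proof -
    have "open (last Vs)" "last Vs \<noteq> {}"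
      using that by (auto simp: legal_history_def last_conv_nth)
    from someI_ex[OF good_ex[OF this]] show ?thesis
      using that(2) by (simp add: \<sigma>_def)
  qed
  have "strategy_I euclidean \<sigma>"
    unfolding strategy_I_def
  proof (intro allI impI)
    fix Vs :: "'r set list" assume "legal_history euclidean \<sigma> Vs"
    then show "openin euclidean (\<sigma> Vs) \<and> \<sigma> Vs \<noteq> {} \<and> (Vs \<noteq> [] \<longrightarrow> \<sigma> Vs \<subseteq> last Vs)"
      using \<sigma>[of Vs] by (cases "Vs = []") (auto simp: \<sigma>_def[of "[]"] good_def)
  qed
  moreover have "\<not> wins_II euclidean D (\<lambda>n. \<sigma> (map V [0..<n])) V"
    if legal: "\<And>n. legal_history euclidean \<sigma> (map V [0..<n])" for V
  proof
    assume wins: "wins_II euclidean D (\<lambda>n. \<sigma> (map V [0..<n])) V"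
    have V: "open (V n)" "V n \<noteq> {}" "V n \<subseteq> \<sigma> (map V [0..<n])" for n
    proof -
      let ?h = "map V [0..<Suc n]"
      have h: "?h ! n = V n" "take n ?h = map V [0..<n]" "n < length ?h"
        by (simp_all add: nth_append take_map)
      have "openin euclidean (?h ! n) \<and> ?h ! n \<noteq> {} \<and> ?h ! n \<subseteq> \<sigma> (take n ?h)"
        using legal[of "Suc n"] h(3) unfolding legal_history_def by blast
      then show "open (V n)" "V n \<noteq> {}" "V n \<subseteq> \<sigma> (map V [0..<n])"
        unfolding h by simp_all
    qed
    have "\<exists>z. good (map V [0..<Suc n]) (\<sigma> (map V [0..<Suc n])) z" for n
      by (rule \<sigma>[OF legal]) simp
    then obtain z where z: "\<And>n. good (map V [0..<Suc n]) (\<sigma> (map V [0..<Suc n])) (z n)"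
      using choice[of "\<lambda>n z. good (map V [0..<Suc n]) (\<sigma> (map V [0..<Suc n])) z"] by blast
    have zL: "z n \<in> L" and sub: "\<sigma> (map V [0..<Suc n]) \<subseteq> V n"
      and near: "\<forall>V\<in>V ` {0..<Suc n}. pick V *m z n \<in> A n"
      and far: "s \<in> \<sigma> (map V [0..<Suc n]) \<Longrightarrow> s *m z n \<notin> closure (A 3)" for n s
      using z[of n] unfolding good_def by (simp_all add: last_map del: upt_Suc)
    have r: "pick (V n) \<in> V n \<inter> D" for n
      by (rule pick[OF V(1,2)])
    have "V (Suc n) \<subseteq> V n" for n
      using V(3)[of "Suc n"] sub[of n] by (rule order_trans)
    then have mono: "V k \<subseteq> V n" if "n \<le> k" for n k
      using that by (rule lift_Suc_antimono_le)
    have "\<not> cluster_point euclidean (\<lambda>n. pick (V n)) p" for p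
    proof (rule no_cluster_of_separated[OF A L, of z])
      show "z n \<in> L" for n by (rule zL)
      show "pick (V j) *m z n \<in> A n" if "j \<le> n" for j n
        using near[of n] that by simp
      show "pick (V k) *m z n \<notin> closure (A 3)" if "n < k" for n k
      proof (rule far)
        show "pick (V k) \<in> \<sigma> (map V [0..<Suc n])"
          using r[of k] mono[OF Suc_leI[OF that]] V(3)[of "Suc n"] by blast
      qed
    qed
    moreover have "\<exists>p. cluster_point euclidean (\<lambda>n. pick (V n)) p"
      using wins r unfolding wins_II_def by simp
    ultimately show False by simp
  qed
  ultimately show ?thesis
    unfolding winning_strategy_I_def by blast
qed

lemma compact_imp_bounded:
  assumes "strongly_Baire (euclidean :: 'r topology)" and K: "compact K"
  shows "R_bounded smul K"
proof (rule ccontr)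
  assume "\<not> R_bounded smul K"
  then obtain U where U: "0 \<in> interior U"
    and unb: "\<And>V. 0 \<in> interior V \<Longrightarrow> \<not> {v *m b | v b. v \<in> V \<and> b \<in> K} \<subseteq> U"
    unfolding R_bounded_def by blast
  obtain A where A: "halving_chain A" "A 0 \<subseteq> interior U"
    using halving_chain_exists[OF open_interior U] by metis
  obtain D :: "'r set" where D: "closure D = UNIV"
    and no: "\<nexists>\<sigma>. winning_strategy_I (euclidean :: 'r topology) D \<sigma>"
    using assms(1) by (auto simp: strongly_Baire_def)
  have "\<exists>v\<in>V. \<exists>x\<in>K. v *m x \<notin> A 0" if "open V" "0 \<in> V" for V
    using unb[of V] that A(2) interior_subset[of U] by (auto simp: interior_open)
  then show False
    using winning_strategy_of_unbounded[OF K A(1) _ D] no by blast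
qed

end

theorem theorem3p2:
  fixes smul :: "'r::topological_ring \<Rightarrow> 'x::{topological_ab_group_add, t2_space} \<Rightarrow> 'x"
  assumes "semitopological_module smul"
  shows "(\<forall>B. R_bounded smul B \<longrightarrow> continuous_on (UNIV \<times> B) (\<lambda>(r, x). smul r x)) \<and>
    (strongly_Baire (euclidean :: 'r topology) \<longrightarrow> (\<forall>K. compact K \<longrightarrow> R_bounded smul K))"
proof -
  interpret semitopological_module smul by fact
  show ?thesis
    using continuous_on_smul_bounded compact_imp_bounded by blast
qed

end
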